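(* Let $p\ge 3$ be a prime, let $\mathbb F$ be a field of characteristic $p$, and let $\lambda\in\mathbb F^p$. Then $$H^1(\mathfrak m_0^\lambda(p))=H^1_*(\mathfrak m_0^\lambda(p)),$$ and the classes of $\{e^1,e^2\}$ form a basis of this space.
   Context: Let $\mathbb F$ be a field of characteristic $p>0$. $\mathfrak m_0(p)$ is the Lie algebra over $\mathbb F$ with basis $e_1,\dots,e_p$ and brackets $[e_1,e_i]=-[e_i,e_1]=e_{i+1}$ for $1<i<p$, all other brackets of basis elements being $0$. For $\lambda=(\lambda_1,\dots,\lambda_p)\in\mathbb F^p$, $\mathfrak m_0^\lambda(p)$ denotes $\mathfrak m_0(p)$ with the restricted structure $\left(\sum_k\alpha_ke_k\right)^{[p]}=\left(\sum_k\alpha_k^p\lambda_k\right)e_p$. Write $\mathfrak g=\mathfrak m_0^\lambda(p)$; $e^1,\dots,e^p$ is the basis of $\mathfrak g^*$ dual to $e_1,\dots,e_p$. All cohomology is with trivial coefficients $\mathbb F$. Ordinary cohomology: $C^0=\mathbb F$, $C^1=\mathfrak g^*$, $C^2=(\wedge^2\mathfrak g)^*$, $d^0=0$, $d^1(\psi)(g,h)=\psi([g,h])$, and $H^1(\mathfrak g)=\ker d^1/\operatorname{im}d^0$. Restricted cohomology: $C^0_*=C^0$, $C^1_*=C^1=\mathfrak g^*$, $d^0_*=0$, $d^1_*(\psi)=(d^1\psi,\operatorname{ind}^1(\psi))$ where $\operatorname{ind}^1(\psi):\mathfrak g\to\mathbb F$ is $\operatorname{ind}^1(\psi)(g)=\psi(g^{[p]})$,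 and $H^1_*(\mathfrak g)=\ker d^1_*/\operatorname{im}d^0_*$. Since $d^0=d^0_*=0$, both $H^1(\mathfrak g)$ and $H^1_*(\mathfrak g)$ are regarded as subspaces of $\mathfrak g^*$. *)

theory Defs
  imports
    "HOL-Computational_Algebra.Computational_Algebra"
    "HOL-Library.Function_Algebras"
begin

definition fscale :: "'a::field \<Rightarrow> ('b \<Rightarrow> 'a) \<Rightarrow> 'b \<Rightarrow> 'a"
  where "fscale c f = (\<lambda>x. c * f x)"

global_interpretation fspace: vector_space fscale
  by unfold_locales (auto simp: fscale_def fun_eq_iff algebra_simps)

text \<open>The element \<open>\<Sum>\<^sub>k \<alpha>\<^sub>k e\<^sub>k\<close> of \<open>m\<^sub>0(p)\<close> is encoded by its coordinate function
  \<open>k \<mapsto> \<alpha>\<^sub>k\<close>, which vanishes off \<open>{1..p}\<close>.\<close>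

definition m0 :: "nat \<Rightarrow> (nat \<Rightarrow> 'a::field) set"
  where "m0 p = {x. \<forall>k. k \<notin> {1..p} \<longrightarrow> x k = 0}"

definition evec :: "nat \<Rightarrow> nat \<Rightarrow> 'a::field"
  where "evec i = (\<lambda>k. if k = i then 1 else 0)"

definition basis_bracket :: "nat \<Rightarrow> nat \<Rightarrow> nat \<Rightarrow> nat \<Rightarrow> 'a::field"
  where "basis_bracket p i j =
    (if i = 1 \<and> 1 < j \<and> j < p then evec (j + 1)
     else if j = 1 \<and> 1 < i \<and> i < p then - evec (i + 1)
     else 0)"

definition bracket :: "nat \<Rightarrow> (nat \<Rightarrow> 'a::field) \<Rightarrow> (nat \<Rightarrow> 'a) \<Rightarrow> nat \<Rightarrow> 'a"
  where "bracket p x y = (\<Sum>i\<in>{1..p}. \<Sum>j\<in>{1..p}. fscale (x i * y j) (basis_bracket p i j))"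

text \<open>Only the values of \<open>\<lambda>\<close> on \<open>{1..p}\<close> matter.\<close>

definition p_map :: "nat \<Rightarrow> (nat \<Rightarrow> 'a::field) \<Rightarrow> (nat \<Rightarrow> 'a) \<Rightarrow> nat \<Rightarrow> 'a"
  where "p_map p lam x = fscale (\<Sum>k\<in>{1..p}. x k ^ p * lam k) (evec p)"

text \<open>Functions on the carrier \<open>m0 p\<close> (functionals, bilinear forms and \<open>ind1\<close>) are extended
  by 0 outside it, so that equality of HOL functions is equality on \<open>m0 p\<close>.\<close>

definition dual :: "nat \<Rightarrow> ((nat \<Rightarrow> 'a::field) \<Rightarrow> 'a) set"
  where "dual p = {\<psi>.
    (\<forall>x\<in>m0 p. \<forall>y\<in>m0 p. \<psi> (x + y) = \<psi> x + \<psi> y) \<and>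
    (\<forall>c. \<forall>x\<in>m0 p. \<psi> (fscale c x) = c * \<psi> x) \<and>
    (\<forall>x. x \<notin> m0 p \<longrightarrow> \<psi> x = 0)}"

definition dual_basis :: "nat \<Rightarrow> nat \<Rightarrow> (nat \<Rightarrow> 'a::field) \<Rightarrow> 'a"
  where "dual_basis p i = (\<lambda>x. if x \<in> m0 p then x i else 0)"

definition d0 :: "'a::field \<Rightarrow> (nat \<Rightarrow> 'a) \<Rightarrow> 'a"
  where "d0 c = 0"

definition d1 :: "nat \<Rightarrow> ((nat \<Rightarrow> 'a::field) \<Rightarrow> 'a) \<Rightarrow> (nat \<Rightarrow> 'a) \<Rightarrow> (nat \<Rightarrow> 'a) \<Rightarrow> 'a"
  where "d1 p \<psi> = (\<lambda>g h. if g \<in> m0 p \<and> h \<in> m0 p then \<psi> (bracket p g h) else 0)"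

definition ind1 :: "nat \<Rightarrow> (nat \<Rightarrow> 'a::field) \<Rightarrow> ((nat \<Rightarrow> 'a) \<Rightarrow> 'a) \<Rightarrow> (nat \<Rightarrow> 'a) \<Rightarrow> 'a"
  where "ind1 p lam \<psi> = (\<lambda>g. if g \<in> m0 p then \<psi> (p_map p lam g) else 0)"

definition d0_res :: "'a::field \<Rightarrow> (nat \<Rightarrow> 'a) \<Rightarrow> 'a"
  where "d0_res c = 0"

definition d1_res :: "nat \<Rightarrow> (nat \<Rightarrow> 'a::field) \<Rightarrow> ((nat \<Rightarrow> 'a) \<Rightarrow> 'a) \<Rightarrow>
    ((nat \<Rightarrow> 'a) \<Rightarrow> (nat \<Rightarrow> 'a) \<Rightarrow> 'a) \<times> ((nat \<Rightarrow> 'a) \<Rightarrow> 'a)"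
  where "d1_res p lam \<psi> = (d1 p \<psi>, ind1 p lam \<psi>)"

text \<open>Since the differentials in degree 0 vanish, \<open>H\<^sup>1\<close> and \<open>H\<^sup>1\<^sub>*\<close> are taken as subspaces of the
  dual space, namely the kernels of the differentials in degree 1. The lemmas \<open>H1_quotient\<close> and
  \<open>H1_res_quotient\<close> below identify them with the quotients kernel modulo image, whose classes are
  singletons.\<close>

definition H1 :: "nat \<Rightarrow> ((nat \<Rightarrow> 'a::field) \<Rightarrow> 'a) set"
  where "H1 p = {\<psi>\<in>dual p. d1 p \<psi> = 0}"

definition H1_res :: "nat \<Rightarrow> (nat \<Rightarrow> 'a::field) \<Rightarrow> ((nat \<Rightarrow> 'a) \<Rightarrow> 'a) set"
  where "H1_res p lam = {\<psi>\<in>dual p. d1_res p lam \<psi> = (0, 0)}"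

lemma H1_quotient:
  "{\<psi>\<in>dual p. d1 p \<psi> = 0} // {(\<phi>, \<psi>). \<psi> - \<phi> \<in> range d0} = (\<lambda>\<psi>. {\<psi>}) ` H1 p"
  by (auto simp: H1_def quotient_def d0_def)

lemma H1_res_quotient:
  "{\<psi>\<in>dual p. d1_res p lam \<psi> = (0, 0)} // {(\<phi>, \<psi>). \<psi> - \<phi> \<in> range d0_res} =
    (\<lambda>\<psi>. {\<psi>}) ` H1_res p lam"
  by (auto simp: H1_res_def quotient_def d0_res_def)

end

theory Submission
  imports Defs
begin

text \<open>A 1-cocycle is a functional vanishing on \<open>[g, g]\<close>, which is spanned by \<open>e\<^sub>3, \<dots>, e\<^sub>p\<close>; so the
  cocycles are the combinations of \<open>e\<^sup>1\<close> and \<open>e\<^sup>2\<close>. Since \<open>p \<ge> 3\<close>, the \<open>p\<close>-map takes values in the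
  line through \<open>e\<^sub>p \<in> [g, g]\<close>, and the restrictedness condition is automatic.\<close>

lemma evec_in_m0: "i \<in> {1..p} \<Longrightarrow> evec i \<in> m0 p"
  by (auto simp: m0_def evec_def)

lemma sum_fun_apply: "(\<Sum>i\<in>A. f i) x = (\<Sum>i\<in>A. f i x)"
  by (induction A rule: infinite_finite_induct) auto

lemma bracket_apply:
  "bracket p x y k = (\<Sum>i\<in>{1..p}. \<Sum>j\<in>{1..p}. x i * y j * basis_bracket p i j k)"
  by (simp add: bracket_def sum_fun_apply fscale_def)

lemma bracket_in_m0: "bracket p x y \<in> m0 p"
  by (auto simp: m0_def bracket_apply basis_bracket_def evec_def intro!: sum.neutral)

text \<open>A nonzero basis bracket is, up to sign, \<open>evec (m + 1)\<close> with m > 1, so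
  brackets have no component along e_1 or e_2. This is what makes e^1 and e^2 cocycles.\<close>

lemma bracket_eq_0: "k < 3 \<Longrightarrow> bracket p x y k = 0"
  by (auto simp: bracket_apply basis_bracket_def evec_def intro!: sum.neutral)

lemma bracket_evec:
  assumes "i \<in> {1..p}" "j \<in> {1..p}"
  shows "bracket p (evec i) (evec j) = basis_bracket p i j"
proof
  fix k
  have inner: "(\<Sum>j'\<in>{1..p}. evec i i' * evec j j' * basis_bracket p i' j' k) =
      (if i' = i then basis_bracket p i j k else 0)" for i'
  proof -
    have "(\<Sum>j'\<in>{1..p}. evec i i' * evec j j' * basis_bracket p i' j' k) =
        (\<Sum>j'\<in>{1..p}. if j' = j then evec i i' * basis_bracket p i' j k else 0)"
      by (intro sum.cong) (auto simp: evec_def)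
    also have "\<dots> = (if i' = i then basis_bracket p i j k else 0)"
      using assms(2) by (simp add: evec_def)
    finally show ?thesis .
  qed
  show "bracket p (evec i) (evec j) k = basis_bracket p i j k"
    unfolding bracket_apply inner using assms(1) by simp
qed

lemma dual_add: "\<psi> \<in> dual p \<Longrightarrow> x \<in> m0 p \<Longrightarrow> y \<in> m0 p \<Longrightarrow> \<psi> (x + y) = \<psi> x + \<psi> y"
  by (simp add: dual_def)

lemma dual_fscale: "\<psi> \<in> dual p \<Longrightarrow> x \<in> m0 p \<Longrightarrow> \<psi> (fscale c x) = c * \<psi> x"
  by (simp add: dual_def)

lemma dual_outside: "\<psi> \<in> dual p \<Longrightarrow> x \<notin> m0 p \<Longrightarrow> \<psi> x = 0"
  by (simp add: dual_def)

lemma fscale_in_m0: "x \<in> m0 p \<Longrightarrow> fscale c x \<in> m0 p"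
  by (simp add: m0_def fscale_def)

lemma sum_in_m0: "(\<And>i. i \<in> A \<Longrightarrow> f i \<in> m0 p) \<Longrightarrow> sum f A \<in> m0 p"
  by (simp add: m0_def sum_fun_apply)

lemma dual_sum:
  assumes "\<psi> \<in> dual p" "\<And>i. i \<in> A \<Longrightarrow> f i \<in> m0 p"
  shows "\<psi> (sum f A) = (\<Sum>i\<in>A. \<psi> (f i))"
proof -
  \<comment> \<open>Homogeneity with scalar 0 gives \<psi> 0 = 0. This settles the empty sum and
    also an infinite index set, whose sum is 0 by convention.\<close>
  have "\<psi> (fscale 0 0) = 0 * \<psi> 0"
    by (rule dual_fscale[OF assms(1)]) (simp add: m0_def)
  then have zero: "\<psi> 0 = 0"
    by simp
  from assms(2) show ?thesis
  proof (induction A rule: infinite_finite_induct)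
    case (insert a A)
    \<comment> \<open>Additivity of \<psi> is available only on the carrier, so the partial sum has
      to be known to lie in \<open>m0 p\<close>.\<close>
    have "\<psi> (f a + sum f A) = \<psi> (f a) + \<psi> (sum f A)"
      using insert.prems by (intro dual_add[OF assms(1)] sum_in_m0) auto
    moreover have "\<psi> (sum f A) = (\<Sum>i\<in>A. \<psi> (f i))"
      using insert by blast
    ultimately show ?case
      by (simp only: sum.insert[OF insert.hyps])
  qed (simp_all add: zero)
qed

lemma m0_expand:
  assumes "x \<in> m0 p"
  shows "x = (\<Sum>i\<in>{1..p}. fscale (x i) (evec i))"
proof
  fix k
  have "(\<Sum>i\<in>{1..p}. x i * evec i k) = (\<Sum>i\<in>{1..p}. if i = k then x i else 0)"
    by (intro sum.cong) (auto simp: evec_def)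
  also have "\<dots> = x k"
    using assms by (auto simp: m0_def)
  finally show "x k = (\<Sum>i\<in>{1..p}. fscale (x i) (evec i)) k"
    by (simp add: sum_fun_apply fscale_def)
qed

lemma dual_expand:
  assumes "\<psi> \<in> dual p" "x \<in> m0 p"
  shows "\<psi> x = (\<Sum>i\<in>{1..p}. x i * \<psi> (evec i))"
proof -
  have "\<psi> x = \<psi> (\<Sum>i\<in>{1..p}. fscale (x i) (evec i))"
    using m0_expand[OF assms(2)] by simp
  also have "\<dots> = (\<Sum>i\<in>{1..p}. \<psi> (fscale (x i) (evec i)))"
    by (rule dual_sum[OF assms(1)]) (intro fscale_in_m0 evec_in_m0)
  also have "\<dots> = (\<Sum>i\<in>{1..p}. x i * \<psi> (evec i))"
    by (intro sum.cong refl dual_fscale[OF assms(1)] evec_in_m0)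
  finally show ?thesis .
qed

text \<open>For 3 \<le> k \<le> p the index k - 1 satisfies 1 < k - 1 < p, hence e_k =
  [e_1, e_{k-1}], and the cocycle condition at this pair kills \<psi>(e_k).\<close>

lemma H1_evec_eq_0:
  assumes "\<psi> \<in> H1 p" "k \<in> {3..p}"
  shows "\<psi> (evec k) = 0"
proof -
  have mem: "1 \<in> {1..p}" "k - 1 \<in> {1..p}"
    using assms(2) by auto
  have "d1 p \<psi> (evec 1) (evec (k - 1)) = 0"
    using assms(1) by (simp add: H1_def)
  then have "\<psi> (basis_bracket p 1 (k - 1)) = 0"
    using mem by (simp add: d1_def evec_in_m0 bracket_evec)
  moreover have "basis_bracket p 1 (k - 1) = (evec k :: nat \<Rightarrow> 'a)"
    using assms(2) by (auto simp: basis_bracket_def)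
  ultimately show ?thesis
    by simp
qed

lemma H1_expand:
  assumes "p \<ge> 2" "\<psi> \<in> H1 p"
  shows "\<psi> = fscale (\<psi> (evec 1)) (dual_basis p 1) + fscale (\<psi> (evec 2)) (dual_basis p 2)"
proof
  fix x
  have dual: "\<psi> \<in> dual p"
    using assms(2) by (simp add: H1_def)
  show "\<psi> x = (fscale (\<psi> (evec 1)) (dual_basis p 1) + fscale (\<psi> (evec 2)) (dual_basis p 2)) x"
  proof (cases "x \<in> m0 p")
    case True
    have "\<psi> x = (\<Sum>i\<in>{1..p}. x i * \<psi> (evec i))"
      by (rule dual_expand[OF dual True])
    also have "\<dots> = (\<Sum>i\<in>{1, 2}. x i * \<psi> (evec i))"
    \<comment> \<open>The terms with i \<ge> 3 vanish by the cocycle condition;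
      \<open>p \<ge> 2\<close> ensures that both 1 and 2 occur in the sum.\<close>
    proof (rule sum.mono_neutral_right)
      show "\<forall>i\<in>{1..p} - {1, 2}. x i * \<psi> (evec i) = 0"
        using H1_evec_eq_0[OF assms(2)] by auto
    qed (use assms(1) in auto)
    finally show ?thesis
      using True by (simp add: fscale_def dual_basis_def mult.commute)
  next
    case False
    \<comment> \<open>Outside the carrier both sides are 0, since all functionals are extended by
      0.\<close>
    then show ?thesis
      by (simp add: fscale_def dual_basis_def dual_outside[OF dual])
  qed
qed

lemma dual_basis_combination_in_H1:
  "fscale a (dual_basis p 1) + fscale b (dual_basis p 2) \<in> H1 p"
proof -
  have "fscale a (dual_basis p 1) + fscale b (dual_basis p 2) \<in> dual p"
    by (auto simp: dual_def dual_basis_def fscale_def m0_def algebra_simps)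
  then show ?thesis
    by (auto simp: H1_def d1_def fun_eq_iff fscale_def dual_basis_def bracket_eq_0)
qed

lemma span_dual_basis_eq_H1:
  assumes "p \<ge> 2"
  shows "fspace.span {dual_basis p 1, dual_basis p 2 :: (nat \<Rightarrow> 'a::field) \<Rightarrow> 'a} = H1 p" (is "?S = ?H")
proof
  show "?S \<subseteq> ?H"
  proof
    fix \<psi> :: "(nat \<Rightarrow> 'a) \<Rightarrow> 'a"
    assume "\<psi> \<in> fspace.span {dual_basis p 1, dual_basis p 2}"
    \<comment> \<open>Membership in the span means that subtracting a suitable multiple of e^1
      leaves a multiple of e^2.\<close>
    then obtain a b where "\<psi> - fscale a (dual_basis p 1) = fscale b (dual_basis p 2)"
      unfolding fspace.span_insert[of _ "{dual_basis p 2}"] fspace.span_singleton by blast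
    then have "\<psi> = fscale b (dual_basis p 2) + fscale a (dual_basis p 1)"
      unfolding diff_eq_eq .
    then show "\<psi> \<in> H1 p"
      using dual_basis_combination_in_H1[of a p b] by (metis add.commute)
  qed
  show "?H \<subseteq> ?S"
  proof
    fix \<psi> :: "(nat \<Rightarrow> 'a) \<Rightarrow> 'a"
    assume "\<psi> \<in> H1 p"
    have "fscale (\<psi> (evec 1)) (dual_basis p 1) + fscale (\<psi> (evec 2)) (dual_basis p 2)
        \<in> fspace.span {dual_basis p 1, dual_basis p 2}"
      by (intro fspace.span_add fspace.span_scale fspace.span_base insertI1 insertI2)
    then show "\<psi> \<in> fspace.span {dual_basis p 1, dual_basis p 2}"
      by (simp only: H1_expand[OF assms \<open>\<psi> \<in> H1 p\<close>, symmetric])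
  qed
qed

lemma dual_basis_evec:
  "j \<in> {1..p} \<Longrightarrow> dual_basis p i (evec j) = (if i = j then 1 else 0)"
  by (simp add: dual_basis_def evec_in_m0) (simp add: evec_def)

text \<open>Evaluation at \<open>evec j\<close> separates e^j from the other coordinate functionals.
  Independence of a set does not detect repeated members, so distinctness of e^1 and e^2 has to be
  shown separately.\<close>

lemma inj_on_dual_basis: "inj_on (dual_basis p :: nat \<Rightarrow> (nat \<Rightarrow> 'a::field) \<Rightarrow> 'a) {1..p}"
proof (rule inj_onI)
  fix i j
  assume "i \<in> {1..p}" "j \<in> {1..p}" "dual_basis p i = (dual_basis p j :: (nat \<Rightarrow> 'a) \<Rightarrow> 'a)"
  then show "i = j"
    using dual_basis_evec[of j p i, where ?'a = 'a] dual_basis_evec[of j p j, where ?'a = 'a]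
    by (auto split: if_splits)
qed

lemma independent_dual_basis:
  assumes "p \<ge> 2"
  shows "fspace.independent {dual_basis p 1, dual_basis p 2 :: (nat \<Rightarrow> 'a::field) \<Rightarrow> 'a}"
proof -
  \<comment> \<open>Evaluation at e_2 shows that e^2 is nonzero; below, evaluation at e_1, where e^2
    vanishes, shows that e^1 is not a multiple of e^2.\<close>
  have "dual_basis p 2 (evec 2) \<noteq> (0 :: 'a)"
    using assms by (simp add: dual_basis_evec)
  then have "dual_basis p 2 \<noteq> (0 :: (nat \<Rightarrow> 'a) \<Rightarrow> 'a)"
    by (metis zero_fun_apply)
  moreover have "dual_basis p 1 \<noteq> fscale c (dual_basis p 2 :: (nat \<Rightarrow> 'a) \<Rightarrow> 'a)" for c
  proof
    assume "dual_basis p 1 = fscale c (dual_basis p 2 :: (nat \<Rightarrow> 'a) \<Rightarrow> 'a)"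
    from fun_cong[OF this, of "evec 1"] show False
      using assms by (simp add: fscale_def dual_basis_evec)
  qed
  ultimately show ?thesis
    by (auto simp: fspace.independent_insert fspace.span_singleton)
qed

text \<open>For p \<ge> 3 the index p itself lies in {3..p}, so cocycles vanish at e_p and hence on
  all values of \<open>p_map\<close>. For p = 2 this breaks down: e_p is then e_2, and
  \<open>ind1\<close> of e^2 is nonzero as soon as \<open>lam 1\<close> or \<open>lam 2\<close>
  is.\<close>

lemma H1_res_eq_H1:
  assumes "p \<ge> 3"
  shows "H1_res p lam = H1 p"
proof -
  have "ind1 p lam \<psi> = 0" if "\<psi> \<in> H1 p" for \<psi>
  proof
    fix g
    have "\<psi> \<in> dual p"
      using that by (simp add: H1_def)
    then have "\<psi> (p_map p lam g) = 0"
      unfolding p_map_def using assms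
      by (simp add: dual_fscale evec_in_m0 H1_evec_eq_0[OF that])
    then show "ind1 p lam \<psi> g = 0 g"
      by (simp add: ind1_def)
  qed
  then show ?thesis
    by (auto simp: H1_res_def H1_def d1_res_def)
qed

theorem theorem3p1:
  fixes p :: nat and lam :: "nat \<Rightarrow> 'a::field"
  assumes "prime p" and "p \<ge> 3" and "CHAR('a) = p"
  shows "(H1 p :: ((nat \<Rightarrow> 'a) \<Rightarrow> 'a) set) = H1_res p lam \<and>
    dual_basis p 1 \<noteq> (dual_basis p 2 :: (nat \<Rightarrow> 'a) \<Rightarrow> 'a) \<and>
    fspace.independent {dual_basis p 1, dual_basis p 2 :: (nat \<Rightarrow> 'a) \<Rightarrow> 'a} \<and>
    fspace.span {dual_basis p 1, dual_basis p 2 :: (nat \<Rightarrow> 'a) \<Rightarrow> 'a} = H1 p"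
proof -
  have "p \<ge> 2"
    using assms(2) by simp
  moreover from this have "dual_basis p 1 \<noteq> (dual_basis p 2 :: (nat \<Rightarrow> 'a) \<Rightarrow> 'a)"
    using inj_onD[OF inj_on_dual_basis, of p 1 2] by auto
  ultimately show ?thesis
    using H1_res_eq_H1[OF assms(2), of lam] independent_dual_basis[of p, where ?'a = 'a]
      span_dual_basis_eq_H1[of p, where ?'a = 'a] by simp
qed

end
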